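(* Suppose that the random vector $\mathbf X=(X_1,\dots,X_n)$ takes values in a finite set. Then $\mathbf X$ is a joint mix if and only if it can be represented as a finite linear combination of binary multinomial random vectors, i.e. there exist $K\in\mathbb N$, real constants $a_1,\dots,a_K$ and binary multinomial random vectors $\mathbf Y_1,\dots,\mathbf Y_K$ in $\mathbb R^n$ such that $\mathbf X=\sum_{k=1}^K a_k\mathbf Y_k$.
   Context: A random vector $\mathbf X=(X_1,\dots,X_n)$ is a joint mix if $\sum_{i=1}^nX_i=c$ almost surely for some constant $c\in\mathbb R$. A binary multinomial random vector is a random vector $(Y_1,\dots,Y_n)$ taking values in $\{0,1\}^n$ such that $\sum_{i=1}^nY_i=1$ (exactly one component equals $1$); degenerate ones are allowed, and no independence between different vectors is required. All random vectors are defined on the same probability space, and equalities between random vectors are understood almost surely. *)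

theory Defs
  imports "HOL-Probability.Probability"
begin

text \<open>
  Random vectors in \<open>n\<close> dimensions are Borel measurable maps into \<^typ>\<open>real ^ 'n\<close>. Statements about
  their values are properties of the law, hence are required almost surely.
\<close>

definition finitely_valued :: "'a measure \<Rightarrow> ('a \<Rightarrow> real ^ 'n) \<Rightarrow> bool" where
  "finitely_valued M X \<longleftrightarrow> (\<exists>S. finite S \<and> (AE \<omega> in M. X \<omega> \<in> S))"

definition joint_mix :: "'a measure \<Rightarrow> ('a \<Rightarrow> real ^ 'n) \<Rightarrow> bool" where
  "joint_mix M X \<longleftrightarrow>
     X \<in> borel_measurable M \<and> (\<exists>c::real. AE \<omega> in M. (\<Sum>i\<in>UNIV. X \<omega> $ i) = c)"

definition binary_multinomial :: "'a measure \<Rightarrow> ('a \<Rightarrow> real ^ 'n) \<Rightarrow> bool" where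
  "binary_multinomial M Y \<longleftrightarrow>
     Y \<in> borel_measurable M \<and>
     (AE \<omega> in M. (\<forall>i. Y \<omega> $ i \<in> {0, 1}) \<and> (\<Sum>i\<in>UNIV. Y \<omega> $ i) = 1)"

end

theory Submission
  imports Defs
begin

text \<open>
  If \<open>X\<close> takes values in the finite set \<open>S\<close> and its components sum to \<open>c\<close>, fix a coordinate \<open>j\<close>.
  Since \<open>x = c e\<^sub>j + (\<Sum>i. x\<^sub>i (e\<^sub>i - e\<^sub>j))\<close> whenever the components of \<open>x\<close> sum to \<open>c\<close>, the vector \<open>X\<close>
  equals \<open>c e\<^sub>j + (\<Sum>s\<in>S. \<Sum>i. s\<^sub>i (Y\<^sub>s\<^sub>,\<^sub>i - e\<^sub>j))\<close>, where \<open>Y\<^sub>s\<^sub>,\<^sub>i\<close> is \<open>e\<^sub>i\<close> on the event \<open>X = s\<close> and \<open>e\<^sub>j\<close>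
  elsewhere. Collecting the constant terms leaves a combination of the multinomial vectors \<open>Y\<^sub>s\<^sub>,\<^sub>i\<close>
  and \<open>e\<^sub>j\<close>.
\<close>

lemma binary_multinomial_axis:
  assumes "Measurable.pred M P"
  shows "binary_multinomial M (\<lambda>\<omega>. if P \<omega> then axis i 1 else axis j 1 :: real ^ 'n)"
  using assms unfolding binary_multinomial_def
  by (auto simp: axis_def intro!: measurable_If)

text \<open>Each \<open>Y k\<close> has component sum 1 almost surely, so the component sum of
  \<open>X\<close> is almost surely the constant \<open>\<Sum>k\<in>I. a k\<close>; as
  \<open>I\<close> is finite, the exceptional null sets can be merged.\<close>

lemma joint_mix_linear_combination:
  fixes Y :: "'k \<Rightarrow> 'a \<Rightarrow> real ^ 'n"
  assumes "finite I" and "X \<in> borel_measurable M"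
    and Y: "\<And>k. k \<in> I \<Longrightarrow> binary_multinomial M (Y k)"
    and X: "AE \<omega> in M. X \<omega> = (\<Sum>k\<in>I. a k *\<^sub>R Y k \<omega>)"
  shows "joint_mix M X"
proof -
  have "AE \<omega> in M. \<forall>k\<in>I. (\<Sum>i\<in>UNIV. Y k \<omega> $ i) = 1"
    using \<open>finite I\<close> Y by (intro AE_finite_allI) (auto simp: binary_multinomial_def)
  with X have "AE \<omega> in M. (\<Sum>i\<in>UNIV. X \<omega> $ i) = (\<Sum>k\<in>I. a k)"
  proof eventually_elim
    case (elim \<omega>)
    have "(\<Sum>i\<in>UNIV. X \<omega> $ i) = (\<Sum>k\<in>I. a k * (\<Sum>i\<in>UNIV. Y k \<omega> $ i))"
      unfolding elim(1) by (simp add: sum_distrib_left sum.swap[of _ I])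
    with elim(2) show ?case by simp
  qed
  with assms(2) show ?thesis unfolding joint_mix_def by blast
qed

text \<open>Subtracting \<open>axis j 1\<close> from every vector of the basis expansion costs a
  multiple of it that depends on \<open>x\<close> only through the component sum, which is constant
  for a joint mix.\<close>

lemma vec_eq_sum_axis_diff:
  fixes x :: "real ^ 'n"
  shows "(\<Sum>i\<in>UNIV. (x $ i) *\<^sub>R (axis i 1 - axis j 1)) = x - (\<Sum>i\<in>UNIV. x $ i) *\<^sub>R axis j 1"
  using basis_expansion[of x]
  by (simp add: scaleR_diff_right sum_subtractf scaleR_sum_left scalar_mult_eq_scaleR)

lemma joint_mix_imp_linear_combination:
  fixes X :: "'a \<Rightarrow> real ^ 'n"
  assumes mix: "joint_mix M X" and "finitely_valued M X"
  obtains I :: "((real ^ 'n) \<times> 'n) option set" and a Y where "finite I"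
    and "\<And>k. k \<in> I \<Longrightarrow> binary_multinomial M (Y k)"
    and "AE \<omega> in M. X \<omega> = (\<Sum>k\<in>I. a k *\<^sub>R Y k \<omega>)"
proof -
  from mix obtain c where X[measurable]: "X \<in> borel_measurable M"
    and c: "AE \<omega> in M. (\<Sum>i\<in>UNIV. X \<omega> $ i) = c"
    unfolding joint_mix_def by blast
  from assms(2) obtain S where "finite S" and S: "AE \<omega> in M. X \<omega> \<in> S"
    unfolding finitely_valued_def by blast
  \<comment> \<open>\<open>undefined\<close> is an arbitrary choice of the coordinate j.\<close>
  define e :: "real ^ 'n" where "e = axis undefined 1"
  \<comment> \<open>\<open>None\<close> indexes the constant vector \<open>e\<close>, and
    \<open>Some (s, i)\<close> the vector switching to \<open>axis i 1\<close> on the event X =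
    s.\<close>
  define I where "I = insert None (Some ` (S \<times> (UNIV :: 'n set)))"
  \<comment> \<open>Expanding the differences with \<open>e\<close> gives \<open>e\<close> the total
    weight \<open>- t\<close>, hence the coefficient \<open>c - t\<close> at
    \<open>None\<close>.\<close>
  define t where "t = (\<Sum>s\<in>S. \<Sum>i\<in>UNIV. s $ i)"
  define a where "a = case_option (c - t) (\<lambda>(s, i :: 'n). s $ i)"
  define Y where "Y = case_option (\<lambda>\<omega>. e) (\<lambda>(s, i) \<omega>. if X \<omega> = s then axis i 1 else e)"
  show thesis
  proof
    show "finite I" unfolding I_def using \<open>finite S\<close> by simp
  next
    fix k assume "k \<in> I"
    show "binary_multinomial M (Y k)"
    proof (cases k)
      case None
      then show ?thesis
        using binary_multinomial_axis[where P = "\<lambda>_. True"] by (simp add: Y_def e_def)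
    next
      case (Some p)
      then show ?thesis
        unfolding Y_def e_def by (cases p) (auto intro!: binary_multinomial_axis)
    qed
  next
    from c S show "AE \<omega> in M. X \<omega> = (\<Sum>k\<in>I. a k *\<^sub>R Y k \<omega>)"
    proof eventually_elim
      case (elim \<omega>)
      \<comment> \<open>Off the event X = s the difference is \<open>e - e = 0\<close>, so only the
        summand with \<open>s = X \<omega>\<close> survives.\<close>
      have "(\<Sum>s\<in>S. \<Sum>i\<in>UNIV. (s $ i) *\<^sub>R ((if X \<omega> = s then axis i 1 else e) - e))
          = (\<Sum>s\<in>S. if X \<omega> = s then \<Sum>i\<in>UNIV. (s $ i) *\<^sub>R (axis i 1 - e) else 0)"
        by (intro sum.cong) auto
      also have "\<dots> = X \<omega> - c *\<^sub>R e"
        using \<open>finite S\<close> elim by (simp add: e_def vec_eq_sum_axis_diff)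
      finally have "(\<Sum>s\<in>S. \<Sum>i\<in>UNIV. (s $ i) *\<^sub>R (if X \<omega> = s then axis i 1 else e))
          = X \<omega> - c *\<^sub>R e + t *\<^sub>R e"
        by (simp add: t_def scaleR_diff_right sum_subtractf scaleR_sum_left algebra_simps)
      moreover have "(\<Sum>k\<in>I. a k *\<^sub>R Y k \<omega>) = (c - t) *\<^sub>R e
          + (\<Sum>s\<in>S. \<Sum>i\<in>UNIV. (s $ i) *\<^sub>R (if X \<omega> = s then axis i 1 else e))"
        using \<open>finite S\<close>
        by (simp add: I_def a_def Y_def sum.reindex sum.cartesian_product case_prod_unfold)
      ultimately show ?case by (simp add: algebra_simps)
    qed
  qed
qed

theorem theorem3:
  fixes M :: "'a measure" and X :: "'a \<Rightarrow> real ^ 'n"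
  assumes "prob_space M"
    and "X \<in> borel_measurable M"
    and "finitely_valued M X"
  shows "joint_mix M X \<longleftrightarrow>
    (\<exists>(K::nat) (a :: nat \<Rightarrow> real) (Y :: nat \<Rightarrow> 'a \<Rightarrow> real ^ 'n).
       (\<forall>k\<in>{1..K}. binary_multinomial M (Y k)) \<and>
       (AE \<omega> in M. X \<omega> = (\<Sum>k=1..K. a k *\<^sub>R Y k \<omega>)))"
    (is "_ \<longleftrightarrow> ?R")
proof
  assume "joint_mix M X"
  then obtain I :: "((real ^ 'n) \<times> 'n) option set" and a Y where "finite I"
    and Y: "\<And>k. k \<in> I \<Longrightarrow> binary_multinomial M (Y k)"
    and X: "AE \<omega> in M. X \<omega> = (\<Sum>k\<in>I. a k *\<^sub>R Y k \<omega>)"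
    using assms(3) by (rule joint_mix_imp_linear_combination) (rule that)
  from \<open>finite I\<close> obtain h where h: "bij_betw h {1..card I} I"
    using ex_bij_betw_nat_finite_1 by blast
  have "\<forall>k\<in>{1..card I}. binary_multinomial M (Y (h k))"
    using Y bij_betwE[OF h] by blast
  moreover have "AE \<omega> in M. X \<omega> = (\<Sum>k=1..card I. a (h k) *\<^sub>R Y (h k) \<omega>)"
    using X by (subst sum.reindex_bij_betw[OF h])
  \<comment> \<open>The enumeration \<open>h\<close> of \<open>I\<close> renumbers coefficients and
    vectors from 1 to \<open>card I\<close>.\<close>
  ultimately show ?R
    by (intro exI[of _ "card I"] exI[of _ "a \<circ> h"] exI[of _ "Y \<circ> h"]) simp
next
  assume ?R
  then show "joint_mix M X"
    using assms(2) by (blast intro: joint_mix_linear_combination[OF finite_atLeastAtMost])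
qed

end
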